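(* There are $2^{\aleph_0}$ (continuum many) hereditary classes which are minimal within the class of finite indecomposable loopless directed graphs; likewise there are $2^{\aleph_0}$ hereditary classes which are minimal within the class of finite indecomposable undirected graphs with loops.
   Context: A directed graph is a set $V$ with a binary relation $\rho$; loopless means $(x,x)\notin\rho$ for all $x$. An undirected graph with loops is a set with a symmetric binary relation (loops allowed). $A\subseteq V$ is an interval if for all $a,a'\in A$ and $x\notin A$: $x\rho a\Leftrightarrow x\rho a'$ and $a\rho x\Leftrightarrow a'\rho x$; the graph is indecomposable if its only intervals are $\emptyset$, singletons and $V$. Embedding: isomorphism onto an induced subgraph. Within a class $\mathcal{K}$ of finite indecomposable graphs (up to isomorphism), a subclass is hereditary if it contains every member of $\mathcal{K}$ embeddable into one of its members, and it is minimal if it is hereditary, infinite, and every proper hereditary subclass is finite. *)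

theory Defs
  imports "Graph_Theory.Graph_Theory" "HOL-Library.Equipollence"
begin

text \<open>
  A graph (a set with a binary relation on it) is a \<open>pair_pre_digraph\<close>, i.e. a vertex set
  \<open>pverts G\<close> together with a relation \<open>parcs G\<close>, contained in \<open>pverts G \<times> pverts G\<close>.
\<close>

definition interval :: "'a pair_pre_digraph \<Rightarrow> 'a set \<Rightarrow> bool" where
  "interval G A \<longleftrightarrow> A \<subseteq> pverts G \<and>
     (\<forall>a\<in>A. \<forall>a'\<in>A. \<forall>x\<in>pverts G - A.
        ((x, a) \<in> parcs G \<longleftrightarrow> (x, a') \<in> parcs G) \<and>
        ((a, x) \<in> parcs G \<longleftrightarrow> (a', x) \<in> parcs G))"

definition indecomposable :: "'a pair_pre_digraph \<Rightarrow> bool" where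
  "indecomposable G \<longleftrightarrow> (\<forall>A. interval G A \<longrightarrow> A = {} \<or> (\<exists>a. A = {a}) \<or> A = pverts G)"

definition embeds :: "'a pair_pre_digraph \<Rightarrow> 'a pair_pre_digraph \<Rightarrow> bool" where
  "embeds G H \<longleftrightarrow>
     (\<exists>H'. induced_subgraph H' (with_proj H) \<and> digraph_iso (with_proj G) H')"

text \<open>
  The two ambient classes. The locale \<open>pair_digraph\<close> is a finite loopless relation and
  \<open>pair_pseudo_graph\<close> a finite symmetric relation in which loops are allowed.
\<close>

definition indec_digraphs :: "'a pair_pre_digraph set" where
  "indec_digraphs = {G. pair_digraph G \<and> indecomposable G}"

definition indec_looped_graphs :: "'a pair_pre_digraph set" where
  "indec_looped_graphs = {G. pair_pseudo_graph G \<and> indecomposable G}"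

text \<open>
  Classes of graphs up to isomorphism are rendered as sets of concrete graphs. A hereditary
  class is closed under isomorphism within the ambient class, since isomorphic graphs embed
  into each other; so, over an infinite vertex type, distinct hereditary classes contain
  different isomorphism types of finite graphs. The size of a class, on the other hand, has to
  be measured by its set of isomorphism types.
\<close>

definition hereditary :: "'a pair_pre_digraph set \<Rightarrow> 'a pair_pre_digraph set \<Rightarrow> bool" where
  "hereditary K C \<longleftrightarrow> C \<subseteq> K \<and> (\<forall>H\<in>C. \<forall>G\<in>K. embeds G H \<longrightarrow> G \<in> C)"

definition iso_types :: "'a pair_pre_digraph set \<Rightarrow> 'a pair_pre_digraph set set" where
  "iso_types C = C // {(G, H). digraph_iso (with_proj G) (with_proj H)}"

definition minimal_class :: "'a pair_pre_digraph set \<Rightarrow> 'a pair_pre_digraph set \<Rightarrow> bool" where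
  "minimal_class K C \<longleftrightarrow> hereditary K C \<and> infinite (iso_types C) \<and>
     (\<forall>D. hereditary K D \<and> D \<subset> C \<longrightarrow> finite (iso_types D))"

end

theory Submission
  imports Defs "HOL-Computational_Algebra.Primes"
begin

text \<open>
  A set \<open>S\<close> of naturals gives a Toeplitz word, whose \<open>n\<close>-th letter says whether the 5-adic
  valuation of \<open>n\<close> lies in \<open>S\<close>. Label the one-way infinite path by this word: by turning edges
  into two-way edges in the directed case, by adding loops in the undirected case. An
  indecomposable graph with at least three vertices embeds into such a path only as a window of
  consecutive vertices, and all windows with at least four vertices are indecomposable. The
  word is uniformly recurrent, so every sufficiently long window contains all windows of a given
  length; hence the indecomposable graphs embedding into the labelled path form a minimal class.
  The number of ones in windows of length \<open>5\<^sup>k\<close> is an isomorphism invariant and determines \<open>S\<close>.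
  Conversely, there are only countably many finite graphs on the naturals.
\<close>

section \<open>Embeddings and isomorphism types\<close>

text \<open>The target is a bare relation on a possibly different type, so that graphs can be mapped
  both into finite graphs and into the infinite labelled path.\<close>

definition represents :: "('a \<Rightarrow> 'b) \<Rightarrow> 'a pair_pre_digraph \<Rightarrow> ('b \<Rightarrow> 'b \<Rightarrow> bool) \<Rightarrow> bool" where
  "represents f G R \<longleftrightarrow> inj_on f (pverts G) \<and>
     (\<forall>x\<in>pverts G. \<forall>y\<in>pverts G. (x, y) \<in> parcs G \<longleftrightarrow> R (f x) (f y))"

definition induced :: "('a \<Rightarrow> 'a \<Rightarrow> bool) \<Rightarrow> 'a set \<Rightarrow> 'a pair_pre_digraph" where
  "induced R A = \<lparr>pverts = A, parcs = {(x, y). x \<in> A \<and> y \<in> A \<and> R x y}\<rparr>"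

lemma induced_simps [simp]:
  "pverts (induced R A) = A"
  "(x, y) \<in> parcs (induced R A) \<longleftrightarrow> x \<in> A \<and> y \<in> A \<and> R x y"
  by (auto simp: induced_def)

lemma pair_fin_digraph_induced: "finite A \<Longrightarrow> pair_fin_digraph (induced R A)"
proof
  assume "finite A"
  moreover have "parcs (induced R A) \<subseteq> A \<times> A"
    by (auto simp: induced_def)
  ultimately show "finite (parcs (induced R A))"
    using finite_subset by blast
qed (auto simp: induced_def)

lemma digraph_iso_image:
  assumes "pair_wf_digraph G" and "inj_on f (pverts G)"
  shows "digraph_iso (with_proj G)
    (with_proj \<lparr>pverts = f ` pverts G, parcs = map_prod f f ` parcs G\<rparr>)"
proof -
  interpret pair_wf_digraph G by fact
  \<comment> \<open>Arcs are pairs, so the vertex map forces the arc map.\<close>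
  define h where "h = \<lparr>iso_verts = f, iso_arcs = map_prod f f, iso_head = snd, iso_tail = fst\<rparr>"
  have "parcs G \<subseteq> pverts G \<times> pverts G"
    using wellformed' by auto
  then have "inj_on (map_prod f f) (parcs G)"
    using map_prod_inj_on[OF assms(2) assms(2)] by (rule inj_on_subset[rotated])
  then have "digraph_isomorphism h"
    using assms(2) wf_digraph_wp_iff[of G] assms(1)
    by (auto simp: digraph_isomorphism_def h_def)
  moreover have "with_proj \<lparr>pverts = f ` pverts G, parcs = map_prod f f ` parcs G\<rparr> = app_iso h (with_proj G)"
    by (simp add: with_proj_def app_iso_def h_def)
  ultimately show ?thesis
    unfolding digraph_iso_def by blast
qed

lemma embeds_if_represents:
  assumes G: "pair_wf_digraph G" and H: "pair_wf_digraph H"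
    and f: "represents f G (\<lambda>x y. (x, y) \<in> parcs H)" and sub: "f ` pverts G \<subseteq> pverts H"
  shows "embeds G H"
proof -
  let ?I = "\<lparr>pverts = f ` pverts G, parcs = map_prod f f ` parcs G\<rparr>"
  interpret G: pair_wf_digraph G by fact
  have iff: "(x, y) \<in> parcs G \<longleftrightarrow> (f x, f y) \<in> parcs H" if "x \<in> pverts G" "y \<in> pverts G" for x y
    using f that by (auto simp: represents_def)
  have arcs: "parcs ?I = {e \<in> parcs H. fst e \<in> f ` pverts G \<and> snd e \<in> f ` pverts G}"
  proof (intro subset_antisym subsetI)
    fix e assume "e \<in> parcs ?I"
    then obtain x y where "(x, y) \<in> parcs G" "e = (f x, f y)" by auto
    then show "e \<in> {e \<in> parcs H. fst e \<in> f ` pverts G \<and> snd e \<in> f ` pverts G}"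
      using iff[of x y] G.wellformed'[of x y] by auto
  next
    fix e assume "e \<in> {e \<in> parcs H. fst e \<in> f ` pverts G \<and> snd e \<in> f ` pverts G}"
    then obtain x y where "x \<in> pverts G" "y \<in> pverts G" "e = (f x, f y)" "e \<in> parcs H"
      by (cases e) auto
    then have "e = map_prod f f (x, y)" "(x, y) \<in> parcs G"
      using iff[of x y] by auto
    then show "e \<in> parcs ?I"
      unfolding pair_pre_digraph.simps by (rule image_eqI)
  qed
  have "wf_digraph (with_proj ?I)"
    using G.wellformed' by unfold_locales auto
  then have "induced_subgraph (with_proj ?I) (with_proj H)"
    using arcs sub H by (auto simp: induced_subgraph_def subgraph_def compatible_def wf_digraph_wp_iff)
  moreover have "digraph_iso (with_proj G) (with_proj ?I)"
    using digraph_iso_image[OF G] f by (auto simp: represents_def)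
  ultimately show ?thesis
    unfolding embeds_def by blast
qed

text \<open>Meant for the subgraph in \<open>embeds\<close>, a general \<open>pre_digraph\<close>:
  compatibility with \<open>with_proj\<close> makes its tail and head the projections, and then the
  vertex map determines the arc map.\<close>

lemma represents_if_digraph_iso:
  assumes iso: "digraph_iso (with_proj G) H" and wf: "pair_wf_digraph G"
    and proj: "tail H = fst" "head H = snd"
  shows "\<exists>f. represents f G (\<lambda>x y. (x, y) \<in> arcs H) \<and> f ` pverts G = verts H"
proof -
  interpret pair_wf_digraph G by fact
  obtain h where h: "digraph_isomorphism h" and H: "H = app_iso h (with_proj G)"
    using iso by (auto simp: digraph_iso_def)
  have inj: "inj_on (iso_verts h) (pverts G)"
    using h by (simp add: digraph_isomorphism_def)
  have arc: "iso_arcs h (x, y) = (iso_verts h x, iso_verts h y)" if "(x, y) \<in> parcs G" for x y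
    using h that proj H by (auto simp: digraph_isomorphism_def prod_eq_iff)
  have "represents (iso_verts h) G (\<lambda>x y. (x, y) \<in> arcs H)"
    unfolding represents_def
  proof (intro conjI ballI iffI inj)
    fix x y assume "(x, y) \<in> parcs G"
    then show "(iso_verts h x, iso_verts h y) \<in> arcs H"
      using arc[of x y] by (force simp: H)
  next
    fix x y assume xy: "x \<in> pverts G" "y \<in> pverts G" "(iso_verts h x, iso_verts h y) \<in> arcs H"
    then obtain a b where ab: "(a, b) \<in> parcs G" "(iso_verts h x, iso_verts h y) = iso_arcs h (a, b)"
      by (auto simp: H)
    then show "(x, y) \<in> parcs G"
      using arc[OF ab(1)] xy wellformed'[OF ab(1)] inj by (auto dest: inj_onD)
  qed
  moreover have "iso_verts h ` pverts G = verts H"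
    by (simp add: H)
  ultimately show ?thesis by blast
qed

lemma represents_if_embeds:
  assumes "embeds G H" and "pair_wf_digraph G"
  shows "\<exists>f. represents f G (\<lambda>x y. (x, y) \<in> parcs H) \<and> f ` pverts G \<subseteq> pverts H"
proof -
  obtain H' where ind: "induced_subgraph H' (with_proj H)" and iso: "digraph_iso (with_proj G) H'"
    using assms(1) by (auto simp: embeds_def)
  then have proj: "tail H' = fst" "head H' = snd"
    and sub: "verts H' \<subseteq> pverts H"
    and arcs: "arcs H' = {e \<in> parcs H. fst e \<in> verts H' \<and> snd e \<in> verts H'}"
    by (auto simp: induced_subgraph_def subgraph_def compatible_def)
  obtain f where f: "represents f G (\<lambda>x y. (x, y) \<in> arcs H')" "f ` pverts G = verts H'"
    using represents_if_digraph_iso[OF iso assms(2) proj] by blast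
  then have "represents f G (\<lambda>x y. (x, y) \<in> parcs H)"
    unfolding represents_def arcs by auto
  with f sub show ?thesis by blast
qed

section \<open>Counting isomorphism types\<close>

abbreviation (input) iso_rel :: "('a pair_pre_digraph \<times> 'a pair_pre_digraph) set" where
  "iso_rel \<equiv> {(G, H). digraph_iso (with_proj G) (with_proj H)}"

lemma iso_class_eq:
  assumes "digraph_iso (with_proj G) (with_proj H)" and "pair_wf_digraph G"
  shows "iso_rel `` {G} = iso_rel `` {H}"
proof -
  have "digraph_iso (with_proj H) (with_proj G)"
    using assms digraph_iso_swap wf_digraph_wp_iff by blast
  with assms(1) show ?thesis
    by (auto intro: digraph_iso_trans)
qed

lemma digraph_iso_refl: "pair_wf_digraph G \<Longrightarrow> digraph_iso (with_proj G) (with_proj G)"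
  using digraph_iso_image[of G id] by (simp add: prod.map_id0 with_proj_def)

lemma card_eq_if_digraph_iso:
  assumes "digraph_iso (with_proj G) (with_proj H)"
  shows "card (pverts H) = card (pverts G)"
  using assms
  by (auto simp: digraph_iso_def with_proj_def app_iso_def pre_digraph.digraph_isomorphism_def card_image)

text \<open>Renumbering moves each graph onto a subset of \<open>{..<n}\<close>, where only finitely
  many graphs live. The renumbered graph may lie outside \<open>C\<close>, which is harmless as
  isomorphism classes are taken among all graphs.\<close>

lemma finite_iso_types_if_card_le:
  fixes C :: "nat pair_pre_digraph set"
  assumes fin: "\<And>G. G \<in> C \<Longrightarrow> pair_fin_digraph G" and card: "\<And>G. G \<in> C \<Longrightarrow> card (pverts G) \<le> n"
  shows "finite (iso_types C)"
proof -
  let ?A = "(\<lambda>(V, E). \<lparr>pverts = V, parcs = E\<rparr>) ` (Pow {..<n} \<times> Pow ({..<n} \<times> {..<n}))"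
  have "iso_types C \<subseteq> (\<lambda>G. iso_rel `` {G}) ` ?A"
  proof
    fix T assume "T \<in> iso_types C"
    then obtain G where G: "G \<in> C" and T: "T = iso_rel `` {G}"
      by (auto simp: iso_types_def quotient_def)
    interpret pair_fin_digraph G using fin[OF G] .
    obtain f where f: "bij_betw f (pverts G) {0..<card (pverts G)}"
      using ex_bij_betw_finite_nat[OF pair_finite_verts] by blast
    have sub: "f ` pverts G \<subseteq> {..<n}"
      using f card[OF G] by (auto simp: bij_betw_def)
    let ?H = "\<lparr>pverts = f ` pverts G, parcs = map_prod f f ` parcs G\<rparr>"
    have "map_prod f f ` parcs G \<subseteq> {..<n} \<times> {..<n}"
      using sub wellformed' by fastforce
    with sub have "?H \<in> ?A"
      by (intro image_eqI[of _ _ "(f ` pverts G, map_prod f f ` parcs G)"]) simp_all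
    moreover have "T = iso_rel `` {?H}"
      unfolding T using f
      by (intro iso_class_eq digraph_iso_image) (auto simp: bij_betw_def pair_wf_digraph_axioms)
    ultimately show "T \<in> (\<lambda>G. iso_rel `` {G}) ` ?A" by blast
  qed
  moreover have "finite ((\<lambda>G. iso_rel `` {G}) ` ?A)"
    by (intro finite_imageI finite_cartesian_product) (simp_all only: finite_Pow_iff finite_cartesian_product finite_lessThan)
  ultimately show ?thesis
    by (rule finite_subset)
qed

text \<open>The number of vertices is constant on an isomorphism type, so finitely many types allow
  only finitely many sizes.\<close>

lemma infinite_iso_types_if_card_unbounded:
  assumes wf: "\<And>G. G \<in> C \<Longrightarrow> pair_wf_digraph G" and unb: "\<And>n. \<exists>G\<in>C. n \<le> card (pverts G)"
  shows "infinite (iso_types C)"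
proof
  assume fin: "finite (iso_types C)"
  define c where "c T = (SOME n. \<exists>G\<in>T. card (pverts G) = n)" for T :: "'a pair_pre_digraph set"
  have c: "c (iso_rel `` {G}) = card (pverts G)" if "G \<in> C" for G
  proof -
    have "G \<in> iso_rel `` {G}"
      using digraph_iso_refl[OF wf[OF that]] by simp
    then have "\<exists>H\<in>iso_rel `` {G}. card (pverts H) = c (iso_rel `` {G})"
      unfolding c_def by (intro someI_ex[of "\<lambda>n. \<exists>H\<in>iso_rel `` {G}. card (pverts H) = n"]) blast
    then show ?thesis
      using card_eq_if_digraph_iso by fastforce
  qed
  have "(\<lambda>G. card (pverts G)) ` C \<subseteq> c ` iso_types C"
  proof
    fix n assume "n \<in> (\<lambda>G. card (pverts G)) ` C"
    then obtain G where "G \<in> C" "n = c (iso_rel `` {G})" using c by auto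
    then show "n \<in> c ` iso_types C" unfolding iso_types_def by (blast intro: quotientI)
  qed
  then have "finite ((\<lambda>G. card (pverts G)) ` C)"
    using fin finite_surj by blast
  moreover obtain G where G: "G \<in> C" "Suc (Max ((\<lambda>G. card (pverts G)) ` C)) \<le> card (pverts G)"
    using unb by blast
  ultimately have "card (pverts G) \<le> Max ((\<lambda>G. card (pverts G)) ` C)"
    by (intro Max_ge imageI)
  with G show False by simp
qed

section \<open>Minimal classes from recurrent paths\<close>

text \<open>Loops and backward arcs are left free: there the undirected and the directed case put
  their labels.\<close>

definition path_like :: "(nat \<Rightarrow> nat \<Rightarrow> bool) \<Rightarrow> bool" where
  "path_like R \<longleftrightarrow> (\<forall>i. R i (Suc i)) \<and> (\<forall>i j. R i j \<longrightarrow> j \<le> Suc i \<and> i \<le> Suc j)"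

text \<open>Uniform recurrence, with returns along an arithmetic progression. Prefixes suffice,
  since every finite set of vertices lies in one.\<close>

definition recurrent :: "(nat \<Rightarrow> nat \<Rightarrow> bool) \<Rightarrow> bool" where
  "recurrent R \<longleftrightarrow>
     (\<forall>n. \<exists>k>0. \<forall>m. \<forall>i<n. \<forall>j<n. R (i + m * k) (j + m * k) \<longleftrightarrow> R i j)"

text \<open>Fraisse's age of the relation, cut down to \<open>K\<close>.\<close>

definition age :: "'a pair_pre_digraph set \<Rightarrow> ('b \<Rightarrow> 'b \<Rightarrow> bool) \<Rightarrow> 'a pair_pre_digraph set" where
  "age K R = {G\<in>K. \<exists>f. represents f G R}"

lemma path_like_adj:
  assumes "path_like R" and "i \<noteq> j"
  shows "R i j \<or> R j i \<longleftrightarrow> j = Suc i \<or> i = Suc j"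
  using assms unfolding path_like_def by (metis le_antisym not_less_eq_eq)

text \<open>A walk in unit steps between \<open>c\<close> and \<open>d\<close> must cross the border
  of \<open>A\<close>. The bound on \<open>x\<close> keeps the crossing inside a given
  window.\<close>

lemma ex_boundary:
  fixes c d :: nat
  assumes "c \<in> A" and "d \<notin> A"
  obtains a x where "a \<in> A" "x \<notin> A" "x = Suc a \<or> a = Suc x" "x \<in> {min c d..max c d}"
proof (cases "c < d")
  case True
  define x where "x = (LEAST x. c < x \<and> x \<notin> A)"
  have x: "c < x" "x \<notin> A" "x \<le> d"
    using LeastI[of "\<lambda>x. c < x \<and> x \<notin> A" d] Least_le[of "\<lambda>x. c < x \<and> x \<notin> A" d] True assms
    by (auto simp: x_def)
  then obtain a where a: "x = Suc a" by (cases x) auto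
  have "a \<in> A"
    using not_less_Least[of a "\<lambda>x. c < x \<and> x \<notin> A"] a x(1) assms(1)
    by (cases "a = c") (auto simp: x_def[symmetric])
  then show ?thesis using that[of a x] a x by auto
next
  case False
  then have "d < c" using assms by (metis nat_neq_iff)
  define a where "a = (LEAST a. d < a \<and> a \<in> A)"
  have a: "d < a" "a \<in> A" "a \<le> c"
    using LeastI[of "\<lambda>a. d < a \<and> a \<in> A" c] Least_le[of "\<lambda>a. d < a \<and> a \<in> A" c] \<open>d < c\<close> assms
    by (auto simp: a_def)
  then obtain x where x: "a = Suc x" by (cases a) auto
  have "x \<notin> A"
    using not_less_Least[of x "\<lambda>a. d < a \<and> a \<in> A"] x a(1) assms(2)
    by (cases "x = d") (auto simp: a_def[symmetric])
  then show ?thesis using that[of a x] x a by auto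
qed

text \<open>Only adjacency in the underlying path matters. A nontrivial interval borders on some
  \<open>x\<close> outside it, and then all its members are neighbours of \<open>x\<close>, so it is
  \<open>{x - 1, x + 1}\<close>. A fourth vertex, \<open>x - 2\<close> or \<open>x + 2\<close>,
  tells these two apart; on three vertices the two ends can form an interval.\<close>

lemma indecomposable_window:
  assumes R: "path_like R" and "4 \<le> L"
  shows "indecomposable (induced R {p..<p + L})"
  unfolding indecomposable_def
proof (intro allI impI)
  fix A assume A: "interval (induced R {p..<p + L}) A"
  let ?W = "{p..<p + L}"
  have sub: "A \<subseteq> ?W"
    using A by (simp add: interval_def)
  have adj: "(a = Suc x \<or> x = Suc a) \<longleftrightarrow> (b = Suc x \<or> x = Suc b)"
    if "a \<in> A" "b \<in> A" "x \<in> ?W" "x \<notin> A" for a b x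
  proof -
    have "a \<in> ?W" "b \<in> ?W" using that sub by auto
    moreover have "x \<in> pverts (induced R ?W) - A" using that by simp
    then have "((x, a) \<in> parcs (induced R ?W) \<longleftrightarrow> (x, b) \<in> parcs (induced R ?W)) \<and>
      ((a, x) \<in> parcs (induced R ?W) \<longleftrightarrow> (b, x) \<in> parcs (induced R ?W))"
      using A that(1,2) unfolding interval_def by blast
    ultimately have "R x a \<longleftrightarrow> R x b" "R a x \<longleftrightarrow> R b x"
      using that(3) unfolding induced_simps by blast+
    moreover have "x \<noteq> a" "x \<noteq> b" using that by auto
    ultimately show ?thesis
      using path_like_adj[OF R, of x a] path_like_adj[OF R, of x b] by blast
  qed
  show "A = {} \<or> (\<exists>a. A = {a}) \<or> A = pverts (induced R ?W)"
  proof (rule ccontr)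
    assume neg: "\<not> ?thesis"
    then have "A \<noteq> {}" "A \<noteq> ?W" by auto
    then obtain c d where cd: "c \<in> A" "d \<in> ?W" "d \<notin> A"
      using sub by blast
    from ex_boundary[OF cd(1,3)] obtain a x where a: "a \<in> A" and x: "x \<notin> A" "x = Suc a \<or> a = Suc x"
      and "x \<in> {min c d..max c d}" by metis
    moreover have "c \<in> ?W" using cd(1) sub by blast
    ultimately have xW: "x \<in> ?W" using cd(2) by auto
    obtain b where b: "b \<in> A" "b \<noteq> a" using neg a by blast
    have nb: "e = Suc x \<or> x = Suc e" if "e \<in> A" for e
      using adj[OF a that xW x(1)] x(2) by argo
    have "x = Suc a \<and> b = Suc x \<or> x = Suc b \<and> a = Suc x"
      using nb[OF a] nb[OF b(1)] b(2) by auto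
    then obtain y where y: "x = Suc y" "y \<in> A" "Suc x \<in> A"
      using a b(1) by metis
    then have yW: "y \<in> ?W" "Suc x \<in> ?W" using sub by blast+
    have "Suc (Suc x) \<in> ?W \<or> (\<exists>z. y = Suc z \<and> z \<in> ?W)"
      using y(1) yW assms(2) by (cases y) auto
    then show False
    proof
      assume "Suc (Suc x) \<in> ?W"
      then show False
        using adj[OF y(2) y(3), of "Suc (Suc x)"] nb[of "Suc (Suc x)"] y(1) by auto
    next
      assume "\<exists>z. y = Suc z \<and> z \<in> ?W"
      then obtain z where z: "y = Suc z" "z \<in> ?W" by blast
      show False
        using adj[OF y(2) y(3) z(2)] nb[of z] y(1) z(1) by auto
    qed
  qed
qed

text \<open>If the image skips a point \<open>c\<close>, the vertices on either side of \<open>c\<close> form two intervals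
  which cover the graph; indecomposability leaves at most one vertex on each side.\<close>

lemma represents_image_window:
  assumes R: "path_like R" and f: "represents f G R" and fin: "finite (pverts G)"
    and ind: "indecomposable G" and card: "3 \<le> card (pverts G)"
  obtains p where "f ` pverts G = {p..<p + card (pverts G)}"
proof -
  let ?V = "pverts G" let ?S = "f ` pverts G"
  have iff: "(x, y) \<in> parcs G \<longleftrightarrow> R (f x) (f y)" if "x \<in> ?V" "y \<in> ?V" for x y
    using f that by (simp add: represents_def)
  have conv: "c \<in> ?S" if "a \<in> ?S" "b \<in> ?S" "a < c" "c < b" for a b c
  proof (rule ccontr)
    assume c: "c \<notin> ?S"
    define A B where "A = {x \<in> ?V. f x < c}" and "B = {x \<in> ?V. c < f x}"
    have V: "?V = A \<union> B" "A \<inter> B = {}" "A \<noteq> {}" "B \<noteq> {}"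
      using that c by (auto simp: A_def B_def)
    \<comment> \<open>\<open>f x\<close> and \<open>f y\<close> lie strictly on opposite sides of
      \<open>c\<close>, so they differ by at least two, and \<open>R\<close> joins no such
      pair.\<close>
    have sep: "(x, y) \<notin> parcs G \<and> (y, x) \<notin> parcs G" if "x \<in> A" "y \<in> B" for x y
      using that R iff[of x y] iff[of y x] by (fastforce simp: A_def B_def path_like_def)
    have "interval G A" "interval G B"
      using V(1,2) sep by (auto simp: interval_def)
    moreover have "A \<noteq> ?V" "B \<noteq> ?V" using V by blast+
    ultimately have "(\<exists>a. A = {a}) \<and> (\<exists>b. B = {b})"
      using ind V(3,4) unfolding indecomposable_def by blast
    then have "card ?V \<le> 2"
      unfolding V(1) by (auto simp: card_insert_if)
    with card show False by simp
  qed
  have S: "finite ?S" "?S \<noteq> {}"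
    using fin card by auto
  have "?S = {Min ?S..Max ?S}"
  proof
    show "{Min ?S..Max ?S} \<subseteq> ?S"
    proof
      fix c assume "c \<in> {Min ?S..Max ?S}"
      then show "c \<in> ?S"
        using conv[OF Min_in[OF S] Max_in[OF S], of c] Min_in[OF S] Max_in[OF S]
        by (cases "c = Min ?S \<or> c = Max ?S") auto
    qed
  qed (use S in auto)
  moreover have "card ?S = card ?V"
    using f by (simp add: represents_def card_image)
  moreover have "card {Min ?S..Max ?S} = Suc (Max ?S) - Min ?S" by simp
  ultimately have "card ?V = Suc (Max ?S) - Min ?S" by metis
  moreover have "Min ?S \<le> Max ?S" using S by simp
  ultimately have "{Min ?S..Max ?S} = {Min ?S..<Min ?S + card ?V}"
    by auto
  with \<open>?S = {Min ?S..Max ?S}\<close> that show ?thesis by metis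
qed

lemma represents_window: "represents id (induced R A) R"
  by (simp add: represents_def)

section \<open>Minimality of the age\<close>

lemma hereditary_age:
  assumes wf: "\<And>G. G \<in> K \<Longrightarrow> pair_wf_digraph G"
  shows "hereditary K (age K R)"
  unfolding hereditary_def
proof (intro conjI ballI impI)
  fix H G assume H: "H \<in> age K R" and G: "G \<in> K" and emb: "embeds G H"
  obtain g where g: "represents g H R" using H by (auto simp: age_def)
  obtain f where f: "represents f G (\<lambda>x y. (x, y) \<in> parcs H)" "f ` pverts G \<subseteq> pverts H"
    using represents_if_embeds[OF emb wf[OF G]] by blast
  have "inj_on f (pverts G)" "inj_on g (f ` pverts G)"
    using f g inj_on_subset by (auto simp: represents_def)
  then have "inj_on (g \<circ> f) (pverts G)"
    by (rule comp_inj_on)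
  moreover have "f x \<in> pverts H" if "x \<in> pverts G" for x
    using f(2) that by blast
  ultimately have "represents (g \<circ> f) G R"
    using f(1) g by (simp add: represents_def)
  with G show "G \<in> age K R" by (auto simp: age_def)
qed (auto simp: age_def)

text \<open>An infinite hereditary subclass \<open>D\<close> has members of unbounded size, which
  are long windows. By recurrence a long enough window contains a copy of any given \<open>H\<close>
  in the age, so heredity puts \<open>H\<close> into \<open>D\<close>.\<close>

lemma minimal_class_age:
  fixes K :: "nat pair_pre_digraph set"
  assumes K: "K \<subseteq> {G. pair_fin_digraph G \<and> indecomposable G}"
    and R: "path_like R" "recurrent R"
    and win: "\<And>L. 4 \<le> L \<Longrightarrow> induced R {0..<L} \<in> K"
  shows "minimal_class K (age K R)"
proof -
  have fin: "pair_fin_digraph G" and ind: "indecomposable G" and wf: "pair_wf_digraph G"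
    if "G \<in> K" for G
    using K that by (auto simp: pair_fin_digraph_def)
  have "infinite (iso_types (age K R))"
  proof (rule infinite_iso_types_if_card_unbounded)
    show "\<exists>G\<in>age K R. n \<le> card (pverts G)" for n
      using win[of "n + 4"] represents_window
      by (intro bexI[of _ "induced R {0..<n + 4}"]) (auto simp: age_def)
  qed (auto simp: age_def wf)
  moreover have "finite (iso_types D)" if D: "hereditary K D" "D \<subset> age K R" for D
  proof (rule ccontr)
    assume inf: "infinite (iso_types D)"
    have "age K R \<subseteq> D"
    proof
      fix H assume H: "H \<in> age K R"
      then obtain g where g: "represents g H R" by (auto simp: age_def)
      have "finite (g ` pverts H)"
        using H fin by (auto simp: age_def pair_fin_digraph.pair_finite_verts)
      then obtain n where n: "g ` pverts H \<subseteq> {..<n}"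
        using finite_nat_bounded by blast
      obtain k where k: "0 < k" "\<And>m i j. i < n \<Longrightarrow> j < n \<Longrightarrow> R (i + m * k) (j + m * k) \<longleftrightarrow> R i j"
        using R(2) unfolding recurrent_def by metis
      \<comment> \<open>A window of length \<open>n + k\<close> contains a translate of the first
        \<open>n\<close> vertices by a multiple of \<open>k\<close>; the 3 secures the size needed
        for the image of \<open>G\<close> to be a window.\<close>
      obtain G where G: "G \<in> D" "n + k + 3 \<le> card (pverts G)"
      proof -
        have "\<exists>G\<in>D. \<not> card (pverts G) \<le> n + k + 3"
          using finite_iso_types_if_card_le[of D "n + k + 3"] inf D(2) fin by (auto simp: age_def)
        then show ?thesis using that by (meson nat_le_linear)
      qed
      then have GK: "G \<in> K" and "G \<in> age K R" using D(2) by (auto simp: age_def)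
      then obtain f where f: "represents f G R" by (auto simp: age_def)
      obtain p where p: "f ` pverts G = {p..<p + card (pverts G)}"
        using represents_image_window[OF R(1) f _ ind[OF GK]] G(2) fin[OF GK]
        by (auto simp: pair_fin_digraph.pair_finite_verts)
      \<comment> \<open>\<open>m * k\<close> is the first multiple of \<open>k\<close> beyond
        \<open>p\<close>.\<close>
      define m where "m = Suc (p div k)"
      have m: "p \<le> m * k" "m * k \<le> p + k"
        using k(1) dividend_less_div_times[of k p] div_times_less_eq_dividend[of p k]
        by (auto simp: m_def)
      \<comment> \<open>The copy of \<open>H\<close> is shifted into the window and pulled back to
        \<open>G\<close>.\<close>
      define h where "h x = inv_into (pverts G) f (g x + m * k)" for x
      have h: "h x \<in> pverts G \<and> f (h x) = g x + m * k" if "x \<in> pverts H" for x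
      proof -
        have "g x < n" using n that by auto
        then have "g x + m * k \<in> f ` pverts G"
          unfolding p using m G(2) by auto
        then show ?thesis
          by (simp add: h_def inv_into_into f_inv_into_f)
      qed
      have "represents h H (\<lambda>x y. (x, y) \<in> parcs G)"
        unfolding represents_def
      proof (intro conjI ballI)
        show "inj_on h (pverts H)"
          using g h by (smt (verit) add_right_cancel inj_on_def represents_def)
      next
        fix x y assume xy: "x \<in> pverts H" "y \<in> pverts H"
        then have "g x < n" "g y < n" using n by auto
        with xy h f g k(2) show "(x, y) \<in> parcs H \<longleftrightarrow> (h x, h y) \<in> parcs G"
          by (simp add: represents_def)
      qed
      moreover have "h ` pverts H \<subseteq> pverts G" using h by auto
      moreover have HK: "H \<in> K" using H by (simp add: age_def)
      ultimately have "embeds H G"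
        by (intro embeds_if_represents wf GK)
      with D(1) G(1) HK show "H \<in> D" by (auto simp: hereditary_def)
    qed
    with D(2) show False by blast
  qed
  ultimately show ?thesis
    using hereditary_age[OF wf] by (auto simp: minimal_class_def)
qed

text \<open>The bijection is an isomorphism of windows but need not be a translation, so only
  invariants such as numbers of arcs or loops are compared through it.\<close>

lemma age_window_transfer:
  assumes K: "K \<subseteq> {G. pair_fin_digraph G \<and> indecomposable G}"
    and R': "path_like R'" and sub: "age K R \<subseteq> age K R'"
    and win: "induced R {0..<L} \<in> K" and "3 \<le> L"
  obtains f q where "bij_betw f {0..<L} {q..<q + L}"
    "\<And>i j. i < L \<Longrightarrow> j < L \<Longrightarrow> R i j \<longleftrightarrow> R' (f i) (f j)"
proof -
  let ?W = "induced R {0..<L}"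
  have "?W \<in> age K R"
    using win represents_window by (auto simp: age_def)
  then obtain f where f: "represents f ?W R'"
    using sub by (auto simp: age_def)
  obtain q where "f ` pverts ?W = {q..<q + card (pverts ?W)}"
    using represents_image_window[OF R' f] K win assms(5) by auto
  with f that[of f q] show ?thesis
    by (auto simp: represents_def bij_betw_def)
qed

section \<open>Toeplitz words\<close>

text \<open>\<open>Suc\<close> keeps out the number 0, whose multiplicity is only a default
  value.\<close>

definition toeplitz :: "nat set \<Rightarrow> nat \<Rightarrow> bool" where
  "toeplitz S i \<longleftrightarrow> multiplicity 5 (Suc i) \<in> S"

lemma multiplicity_5_add_mult:
  fixes n m k :: nat
  assumes "0 < n" and "multiplicity 5 n < k"
  shows "multiplicity 5 (n + m * 5 ^ k) = multiplicity 5 n"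
\<comment> \<open>For \<open>m = 0\<close> the added term is 0, with default multiplicity 0 instead
  of a large one, so the ultrametric argument needs nonzero \<open>m\<close>.\<close>
proof (cases "m = 0")
  case False
  have "prime (5 :: nat)" by simp
  moreover have "k \<le> multiplicity 5 (m * 5 ^ k)"
    using False by (intro multiplicity_geI) auto
  ultimately show ?thesis
    using assms False by (intro multiplicity_sum_lt) auto
qed simp

lemma toeplitz_recurrent:
  assumes "i < n"
  shows "toeplitz S (i + m * 5 ^ n) \<longleftrightarrow> toeplitz S i"
proof -
  \<comment> \<open>For the valuation \<open>v\<close> the crude chain
    \<open>v < 5 ^ v \<le> Suc i \<le> n\<close> makes the exponent \<open>n\<close> large
    enough.\<close>
  have "5 ^ multiplicity 5 (Suc i) \<le> Suc i"
    by (intro dvd_imp_le multiplicity_dvd) simp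
  moreover have "multiplicity 5 (Suc i) < 5 ^ multiplicity 5 (Suc i)"
    by (rule power_gt_expt) simp
  ultimately have "multiplicity 5 (Suc i) < n"
    using assms by linarith
  from multiplicity_5_add_mult[OF _ this, of m] show ?thesis
    by (simp add: toeplitz_def)
qed

section \<open>Counting ones in windows\<close>

lemma card_filter_periodic:
  fixes p P :: nat
  assumes "\<And>i. f (i + P) \<longleftrightarrow> f i"
  shows "card {i \<in> {p..<p + P}. f i} = card {i \<in> {0..<P}. f i}"
proof (induction p)
  case (Suc p)
  \<comment> \<open>Sliding the window by one exchanges \<open>p\<close> for \<open>p + P\<close>,
    where \<open>f\<close> has the same value.\<close>
  have "card {i \<in> {Suc p..<Suc p + P}. f i} = card {i \<in> {p..<p + P}. f i}"
  proof (cases "P = 0")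
    case False
    have "card {i \<in> {Suc p..<Suc p + P}. f i} = (\<Sum>i = Suc p..<Suc (p + P). of_bool (f i))"
      by (subst sum_of_bool_eq) (auto intro!: arg_cong[of _ _ card])
    also have "\<dots> = (\<Sum>i = p..<p + P. of_bool (f i))"
      using False assms[of p] sum.atLeast_Suc_lessThan[of p "p + P" "\<lambda>i. of_bool (f i) :: nat"]
      by simp
    also have "\<dots> = card {i \<in> {p..<p + P}. f i}"
      by (subst sum_of_bool_eq) (auto intro!: arg_cong[of _ _ card])
    finally show ?thesis .
  qed simp
  with Suc show ?case by simp
qed simp

lemma card_window_multiples_le_1:
  fixes p P :: nat
  shows "card {i \<in> {p..<p + P}. P dvd Suc i} \<le> 1"
proof -
  have "i = j" if "i \<in> {p..<p + P}" "j \<in> {p..<p + P}" "P dvd Suc i" "P dvd Suc j" "i \<le> j" for i j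
  proof -
    have "P dvd Suc j - Suc i" using that by (intro dvd_diff_nat)
    moreover have "Suc j - Suc i < P" using that by auto
    ultimately have "Suc j - Suc i = 0" using nat_dvd_not_less by blast
    with that(5) show "i = j" by simp
  qed
  then have "\<forall>i\<in>{i \<in> {p..<p + P}. P dvd Suc i}. \<forall>j\<in>{i \<in> {p..<p + P}. P dvd Suc i}. i = j"
    by (metis (no_types, lifting) mem_Collect_eq nat_le_linear)
  then show ?thesis
    using card_le_Suc0_iff_eq[of "{i \<in> {p..<p + P}. P dvd Suc i}"] by simp
qed

definition ones :: "nat set \<Rightarrow> nat \<Rightarrow> nat \<Rightarrow> nat" where
  "ones S p P = card {i \<in> {p..<p + P}. toeplitz S i}"

text \<open>In a window of length \<open>5\<^sup>k\<^sup>+\<^sup>1\<close>, the letters at positions of valuation at most \<open>k\<close> form a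
  periodic pattern, and only one position has a larger valuation. Valuation \<open>k\<close> itself is taken
  at least twice, which outweighs the letter at that one position.\<close>

lemma ones_less:
  assumes agree: "\<And>i. i < k \<Longrightarrow> i \<in> S \<longleftrightarrow> i \<in> T" and k: "k \<in> S" "k \<notin> T"
  shows "ones T q (5 ^ Suc k) < ones S p (5 ^ Suc k)"
proof -
  define P :: nat where "P = 5 ^ Suc k"
  let ?v = "\<lambda>i. multiplicity 5 (Suc i)"
  define low where "low S i \<longleftrightarrow> ?v i \<le> k \<and> ?v i \<in> S" for S i
  have mult: "multiplicity 5 (c * 5 ^ k) = k" if "\<not> 5 dvd c" for c :: nat
    using that by (intro multiplicity_eqI) auto
  \<comment> \<open>Positions are one less than the numbers whose valuation is taken; these two
    stand for \<open>5 ^ k\<close> and \<open>2 * 5 ^ k\<close>.\<close>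
  have "Suc (5 ^ k - 1) = 1 * 5 ^ k" "Suc (2 * 5 ^ k - 1) = 2 * 5 ^ k" by simp_all
  then have v: "?v (5 ^ k - 1) = k" "?v (2 * 5 ^ k - 1) = k"
    using mult[of 1] mult[of 2] by (simp_all only:) simp_all
  have dvd: "P dvd Suc i \<longleftrightarrow> k < ?v i" for i
    unfolding P_def by (subst power_dvd_iff_le_multiplicity) auto
  have per: "low S (i + P) \<longleftrightarrow> low S i" for S i
  proof (cases "?v i \<le> k")
    case True
    then show ?thesis
      using multiplicity_5_add_mult[of "Suc i" "Suc k" 1] by (simp add: low_def P_def)
  next
    case False
    then have "P dvd Suc (i + P)"
      using dvd[of i] dvd_add_triv_right_iff[of P "Suc i"] by simp
    then show ?thesis using dvd[of "i + P"] False by (simp add: low_def)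
  qed
  \<comment> \<open>The worst case for \<open>T\<close> is a one at the position of valuation above
    \<open>k\<close>; on the side of \<open>S\<close> that position is left uncounted.\<close>
  have "ones T q P \<le> card {i \<in> {q..<q + P}. low T i} + card {i \<in> {q..<q + P}. P dvd Suc i}"
    unfolding ones_def
    by (rule order_trans[OF card_mono card_Un_le]) (auto simp: dvd toeplitz_def low_def)
  also have "\<dots> \<le> card {i \<in> {0..<P}. low T i} + 1"
    using card_filter_periodic[of "low T" P q] per card_window_multiples_le_1[of q P] by simp
  also have "\<dots> < card ({i \<in> {0..<P}. low T i} \<union> {5 ^ k - 1, 2 * 5 ^ k - 1})"
  proof -
    have "(5::nat) ^ k - 1 \<noteq> 2 * 5 ^ k - 1"
      using zero_less_power[of "5::nat" k] by linarith
    moreover have "{i \<in> {0..<P}. low T i} \<inter> {5 ^ k - 1, 2 * 5 ^ k - 1} = {}"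
      using v k by (auto simp: low_def)
    ultimately show ?thesis
      by (subst card_Un_disjoint) auto
  qed
  also have "\<dots> \<le> card {i \<in> {0..<P}. low S i}"
  proof (rule card_mono)
    \<comment> \<open>Since \<open>k \<notin> T\<close>, a position counted for \<open>T\<close> has
      valuation below \<open>k\<close>, where \<open>S\<close> and \<open>T\<close> agree.\<close>
    have "low S i" if "low T i" for i
      using that agree[of "?v i"] k by (cases "?v i = k") (auto simp: low_def)
    moreover have "5 ^ k - 1 < P" "2 * 5 ^ k - 1 < P"
      using zero_less_power[of "5::nat" k] unfolding P_def power_Suc by linarith+
    ultimately show "{i \<in> {0..<P}. low T i} \<union> {5 ^ k - 1, 2 * 5 ^ k - 1} \<subseteq> {i \<in> {0..<P}. low S i}"
      using v k by (auto simp: low_def)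
  qed simp
  also have "\<dots> = card {i \<in> {p..<p + P}. low S i}"
    using card_filter_periodic[of "low S" P p] per by simp
  also have "\<dots> \<le> ones S p P"
    unfolding ones_def by (intro card_mono) (auto simp: toeplitz_def low_def)
  finally show ?thesis unfolding P_def .
qed

text \<open>At the first \<open>k\<close> where the sets differ, every window of length
  \<open>5 ^ Suc k\<close> of one word has more ones than every such window of the other, so one
  equality at unrelated positions is already a contradiction.\<close>

lemma ones_separate:
  assumes "\<And>k. \<exists>p q. ones S p (5 ^ Suc k) = ones T q (5 ^ Suc k)"
  shows "S = T"
proof (rule ccontr)
  assume "S \<noteq> T"
  then have ex: "\<exists>k. (k \<in> S) \<noteq> (k \<in> T)" by auto
  define k where "k = (LEAST k. (k \<in> S) \<noteq> (k \<in> T))"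
  have k: "(k \<in> S) \<noteq> (k \<in> T)"
    unfolding k_def using ex by (rule LeastI_ex)
  have agree: "i \<in> S \<longleftrightarrow> i \<in> T" if "i < k" for i
    using not_less_Least that unfolding k_def by blast
  obtain p q where "ones S p (5 ^ Suc k) = ones T q (5 ^ Suc k)"
    using assms by blast
  then show False
    using k agree ones_less[of k S T q p] ones_less[of k T S p q] by auto
qed

section \<open>Continuum many classes\<close>

lemma lepoll_minimal_classes:
  fixes K :: "nat pair_pre_digraph set"
  assumes "countable K"
  shows "{C. minimal_class K C} \<lesssim> (UNIV :: nat set set)"
proof -
  have "{C. minimal_class K C} \<subseteq> Pow K"
    by (auto simp: minimal_class_def hereditary_def)
  moreover have "Pow K \<lesssim> (UNIV :: nat set set)"
    unfolding lepoll_def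
    using assms by (intro exI[of _ "image (to_nat_on K)"])
      (auto intro: inj_on_image_Pow inj_on_to_nat_on)
  ultimately show ?thesis
    using lepoll_trans subset_imp_lepoll by blast
qed

lemma countable_fin_digraphs:
  "countable {G :: nat pair_pre_digraph. pair_fin_digraph G}"
proof (rule countable_subset)
  let ?F = "Collect finite :: nat set set" let ?E = "Collect finite :: (nat \<times> nat) set set"
  show "{G. pair_fin_digraph G} \<subseteq> (\<lambda>(V, E). \<lparr>pverts = V, parcs = E\<rparr>) ` (?F \<times> ?E)"
  proof
    fix G :: "nat pair_pre_digraph" assume "G \<in> {G. pair_fin_digraph G}"
    then have "(pverts G, parcs G) \<in> ?F \<times> ?E"
      by (auto simp: pair_fin_digraph.pair_finite_verts pair_fin_digraph.pair_finite_arcs)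
    moreover have "G = (\<lambda>(V, E). \<lparr>pverts = V, parcs = E\<rparr>) (pverts G, parcs G)" by simp
    ultimately show "G \<in> (\<lambda>(V, E). \<lparr>pverts = V, parcs = E\<rparr>) ` (?F \<times> ?E)"
      by (rule rev_image_eqI)
  qed
  show "countable ((\<lambda>(V, E). \<lparr>pverts = V, parcs = E\<rparr>) ` (?F \<times> ?E))"
    by (intro countable_image countable_SIGMA countable_Collect_finite)
qed

text \<open>The offset \<open>c\<close> allows for labels on edges, where a window of \<open>P\<close> letters needs \<open>P + 1\<close>
  vertices.\<close>

lemma minimal_classes_eqpoll:
  fixes K :: "nat pair_pre_digraph set" and R :: "nat set \<Rightarrow> nat \<Rightarrow> nat \<Rightarrow> bool"
  assumes K: "K \<subseteq> {G. pair_fin_digraph G \<and> indecomposable G}"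
    and R: "\<And>S. path_like (R S)" "\<And>S. recurrent (R S)"
    and win: "\<And>S L. 4 \<le> L \<Longrightarrow> induced (R S) {0..<L} \<in> K"
    and ones: "\<And>S T f q P.
      \<lbrakk>bij_betw f {0..<P + c} {q..<q + (P + c)};
        \<And>i j. i < P + c \<Longrightarrow> j < P + c \<Longrightarrow> R S i j \<longleftrightarrow> R T (f i) (f j)\<rbrakk>
      \<Longrightarrow> ones S 0 P = ones T q P"
  shows "{C. minimal_class K C} \<approx> (UNIV :: nat set set)"
proof (rule lepoll_antisym)
  have "countable K"
    using countable_subset[OF _ countable_fin_digraphs] K by blast
  then show "{C. minimal_class K C} \<lesssim> (UNIV :: nat set set)"
    by (rule lepoll_minimal_classes)
  have "inj (\<lambda>S. age K (R S))"
  \<comment> \<open>Equal ages share their windows up to isomorphism, so the counts of ones agree at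
    every scale.\<close>
  proof (rule injI, rule ones_separate)
    fix S T k assume eq: "age K (R S) = age K (R T)"
    define L :: nat where "L = 5 ^ Suc k + c"
    \<comment> \<open>The base 5 makes even the shortest window, \<open>k = 0\<close>, long enough
      to be indecomposable.\<close>
    have L: "4 \<le> L" using zero_less_power[of "5::nat" k] unfolding L_def power_Suc by linarith
    obtain f q where "bij_betw f {0..<L} {q..<q + L}"
      "\<And>i j. i < L \<Longrightarrow> j < L \<Longrightarrow> R S i j \<longleftrightarrow> R T (f i) (f j)"
      using age_window_transfer[OF K R(1) equalityD1[OF eq] win[OF L]] L by auto
    then show "\<exists>p q. ones S p (5 ^ Suc k) = ones T q (5 ^ Suc k)"
      using ones[of f "5 ^ Suc k" q S T] unfolding L_def by blast
  qed
  moreover have "range (\<lambda>S. age K (R S)) \<subseteq> {C. minimal_class K C}"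
    using minimal_class_age[OF K R win] by blast
  ultimately show "(UNIV :: nat set set) \<lesssim> {C. minimal_class K C}"
    by (auto simp: lepoll_def)
qed

section \<open>The two labelled paths\<close>

lemma recurrent_toeplitz_relation:
  assumes "\<And>i j d. toeplitz S (i + d) = toeplitz S i \<Longrightarrow> toeplitz S (j + d) = toeplitz S j
    \<Longrightarrow> R (i + d) (j + d) = R i j"
  shows "recurrent R"
  unfolding recurrent_def
proof
  fix n
  \<comment> \<open>Shifting by a multiple of \<open>5 ^ n\<close> keeps all letters below
    \<open>n\<close>, and \<open>R\<close> ignores shifts that keep the letters at both
    vertices.\<close>
  have "R (i + m * 5 ^ n) (j + m * 5 ^ n) \<longleftrightarrow> R i j" if "i < n" "j < n" for m i j
    using toeplitz_recurrent[OF that(1), of S m] toeplitz_recurrent[OF that(2), of S m]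
    by (intro assms)
  then show "\<exists>k>0. \<forall>m. \<forall>i<n. \<forall>j<n. R (i + m * k) (j + m * k) \<longleftrightarrow> R i j"
    by (intro exI[of _ "5 ^ n"]) simp
qed

text \<open>Loops are forbidden here, so the letter \<open>j\<close> is carried by the edge between
  \<open>j\<close> and \<open>Suc j\<close>.\<close>

definition dipath :: "nat set \<Rightarrow> nat \<Rightarrow> nat \<Rightarrow> bool" where
  "dipath S i j \<longleftrightarrow> j = Suc i \<or> i = Suc j \<and> toeplitz S j"

definition looped_path :: "nat set \<Rightarrow> nat \<Rightarrow> nat \<Rightarrow> bool" where
  "looped_path S i j \<longleftrightarrow> j = Suc i \<or> i = Suc j \<or> i = j \<and> toeplitz S i"

text \<open>This isomorphism invariant reveals the ones: each of the \<open>P\<close> edges has a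
  forward arc, and each letter one adds a backward arc.\<close>

lemma card_dipath_arcs:
  "card {(i, j). i \<in> {q..<q + Suc P} \<and> j \<in> {q..<q + Suc P} \<and> dipath S i j} = P + ones S q P"
proof -
  let ?A = "(\<lambda>i. (i, Suc i)) ` {q..<q + P}"
  let ?B = "(\<lambda>i. (Suc i, i)) ` {i \<in> {q..<q + P}. toeplitz S i}"
  have "{(i, j). i \<in> {q..<q + Suc P} \<and> j \<in> {q..<q + Suc P} \<and> dipath S i j} = ?A \<union> ?B"
    by (auto simp: dipath_def)
  moreover have "card (?A \<union> ?B) = card ?A + card ?B"
    by (intro card_Un_disjoint) auto
  moreover have "card ?A = P" "card ?B = ones S q P"
    by (auto simp: card_image inj_on_def ones_def)
  ultimately show ?thesis by simp
qed

lemma minimal_indec_digraphs_eqpoll: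
  "{C. minimal_class (indec_digraphs :: nat pair_pre_digraph set) C} \<approx> (UNIV :: nat set set)"
proof (rule minimal_classes_eqpoll[where R = dipath and c = 1])
  show "(indec_digraphs :: nat pair_pre_digraph set) \<subseteq> {G. pair_fin_digraph G \<and> indecomposable G}"
    by (auto simp: indec_digraphs_def pair_digraph_def)
  show pl: "path_like (dipath S)" for S
    by (auto simp: path_like_def dipath_def)
  show "recurrent (dipath S)" for S
    by (rule recurrent_toeplitz_relation[of S]) (auto simp: dipath_def)
  show "induced (dipath S) {0..<L} \<in> indec_digraphs" if "4 \<le> L" for S L
  proof -
    interpret pair_fin_digraph "induced (dipath S) {0..<L}"
      by (rule pair_fin_digraph_induced) simp
    have "pair_digraph (induced (dipath S) {0..<L})"
      by unfold_locales (auto simp: induced_def dipath_def)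
    then show ?thesis
      using indecomposable_window[OF pl that, of S 0] by (simp add: indec_digraphs_def)
  qed
  fix S T f q P
  assume f: "bij_betw f {0..<P + 1} {q..<q + (P + 1)}"
    and iff: "\<And>i j. i < P + 1 \<Longrightarrow> j < P + 1 \<Longrightarrow> dipath S i j \<longleftrightarrow> dipath T (f i) (f j)"
  \<comment> \<open>The isomorphism matches the arcs; cancelling the \<open>P\<close> forward arcs
    on both sides equates the ones.\<close>
  have "bij_betw (map_prod f f)
    {(i, j). i \<in> {0..<0 + Suc P} \<and> j \<in> {0..<0 + Suc P} \<and> dipath S i j}
    {(i, j). i \<in> {q..<q + Suc P} \<and> j \<in> {q..<q + Suc P} \<and> dipath T i j}"
  proof (rule bij_betw_imageI)
    have inj: "inj_on f {0..<Suc P}" and im: "f ` {0..<Suc P} = {q..<q + Suc P}"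
      using f by (auto simp: bij_betw_def)
    show "inj_on (map_prod f f) {(i, j). i \<in> {0..<0 + Suc P} \<and> j \<in> {0..<0 + Suc P} \<and> dipath S i j}"
      by (rule inj_on_subset[OF map_prod_inj_on[OF inj inj]]) auto
    show "map_prod f f ` {(i, j). i \<in> {0..<0 + Suc P} \<and> j \<in> {0..<0 + Suc P} \<and> dipath S i j} =
      {(i, j). i \<in> {q..<q + Suc P} \<and> j \<in> {q..<q + Suc P} \<and> dipath T i j}"
      unfolding im[symmetric] using iff by (auto simp: image_iff)
  qed
  from bij_betw_same_card[OF this] show "ones S 0 P = ones T q P"
    unfolding card_dipath_arcs by simp
qed

lemma minimal_indec_looped_graphs_eqpoll:
  "{C. minimal_class (indec_looped_graphs :: nat pair_pre_digraph set) C} \<approx> (UNIV :: nat set set)"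
proof (rule minimal_classes_eqpoll[where R = looped_path and c = 0])
  show "(indec_looped_graphs :: nat pair_pre_digraph set) \<subseteq> {G. pair_fin_digraph G \<and> indecomposable G}"
    by (auto simp: indec_looped_graphs_def pair_pseudo_graph_def)
  show pl: "path_like (looped_path S)" for S
    by (auto simp: path_like_def looped_path_def)
  show "recurrent (looped_path S)" for S
    by (rule recurrent_toeplitz_relation[of S]) (auto simp: looped_path_def)
  show "induced (looped_path S) {0..<L} \<in> indec_looped_graphs" if "4 \<le> L" for S L
  proof -
    interpret pair_fin_digraph "induced (looped_path S) {0..<L}"
      by (rule pair_fin_digraph_induced) simp
    have "pair_pseudo_graph (induced (looped_path S) {0..<L})"
      by unfold_locales (auto simp: symmetric_def sym_def looped_path_def)
    then show ?thesis
      using indecomposable_window[OF pl that, of S 0] by (simp add: indec_looped_graphs_def)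
  qed
  fix S T f q P
  assume f: "bij_betw f {0..<P + 0} {q..<q + (P + 0)}"
    and iff: "\<And>i j. i < P + 0 \<Longrightarrow> j < P + 0 \<Longrightarrow> looped_path S i j \<longleftrightarrow> looped_path T (f i) (f j)"
  \<comment> \<open>Taking \<open>j = i\<close> isolates the loops, which mark exactly the ones of
    the word.\<close>
  have "toeplitz T (f i) \<longleftrightarrow> toeplitz S i" if "i \<in> {0..<0 + P}" for i
    using iff[of i i] that by (simp add: looped_path_def)
  with f have "bij_betw f {i \<in> {0..<0 + P}. toeplitz S i} {i \<in> {q..<q + P}. toeplitz T i}"
    by (intro bij_betw_Collect) simp_all
  then show "ones S 0 P = ones T q P"
    unfolding ones_def by (rule bij_betw_same_card)
qed

theorem theorem5p17:
  shows "{C. minimal_class (indec_digraphs :: nat pair_pre_digraph set) C} \<approx> (UNIV :: nat set set)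
    \<and> {C. minimal_class (indec_looped_graphs :: nat pair_pre_digraph set) C} \<approx> (UNIV :: nat set set)"
  using minimal_indec_digraphs_eqpoll minimal_indec_looped_graphs_eqpoll by blast

end
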